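(* Every virtually polycyclic group has finite periodic asymptotic dimension.
   Context: A group $G$ is polycyclic if there is a sequence of subgroups $1 = G_0 \leq G_1 \leq \cdots \leq G_n = G$ with each $G_i$ normal in $G_{i+1}$ and each quotient $G_{i+1}/G_i$ cyclic; a group is virtually polycyclic if it has a polycyclic subgroup of finite index. Periodic asymptotic dimension: let $G$ be a finitely generated group with a fixed finite symmetric generating set and word norm $|\cdot|$. $G$ acts on $\{1,\ldots,n\}^G$ by $(gx)_h = x_{g^{-1}h}$, and a configuration $x$ is periodic if its stabilizer has finite index in $G$. For $n, r, m \in \mathbb{N}$ let $X_{n,r,m} \subset \{1,\ldots,n\}^G$ be the set of $x$ such that for each color $c \in \{1,\ldots,n\}$, the graph with vertex set $\{a \in G : x_a = c\}$ and edges $\{(a,b) : x_a = x_b = c,\ |a^{-1}b| \leq r\}$ has all connected components of cardinality at most $m$. The periodic asymptotic dimension $\mathrm{pdim}(G)$ is the infimum of all $d \in \mathbb{N}$ such that for all $r$ there exists $m$ such that $X_{d+1,r,m}$ contains a periodic point (it is $\infty$ if no such $d$ exists). It does not depend on the choice of finite generating set. *)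

theory Defs
  imports
    "HOL-Algebra.Algebra"
    "HOL-Library.Extended_Nat"
    "HOL-Library.FuncSet"
begin

definition polycyclic :: "('a, 'b) monoid_scheme \<Rightarrow> bool" where
  "polycyclic G \<longleftrightarrow>
     (\<exists>(n::nat) (Gs :: nat \<Rightarrow> 'a set).
        Gs 0 = {\<one>\<^bsub>G\<^esub>} \<and> Gs n = carrier G \<and>
        (\<forall>i\<le>n. subgroup (Gs i) G) \<and>
        (\<forall>i<n. Gs i \<lhd> (G\<lparr>carrier := Gs (Suc i)\<rparr>) \<and>
               cyclic_group ((G\<lparr>carrier := Gs (Suc i)\<rparr>) Mod (Gs i))))"

definition finite_index :: "('a, 'b) monoid_scheme \<Rightarrow> 'a set \<Rightarrow> bool" where
  "finite_index G H \<longleftrightarrow> subgroup H G \<and> finite (rcosets\<^bsub>G\<^esub> H)"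

definition virtually_polycyclic :: "('a, 'b) monoid_scheme \<Rightarrow> bool" where
  "virtually_polycyclic G \<longleftrightarrow>
     (\<exists>H. finite_index G H \<and> polycyclic (G\<lparr>carrier := H\<rparr>))"

definition finite_symmetric_generating_set ::
    "('a, 'b) monoid_scheme \<Rightarrow> 'a set \<Rightarrow> bool" where
  "finite_symmetric_generating_set G S \<longleftrightarrow>
     finite S \<and> S \<subseteq> carrier G \<and> (\<forall>s\<in>S. inv\<^bsub>G\<^esub> s \<in> S) \<and> generate G S = carrier G"

definition word_norm :: "('a, 'b) monoid_scheme \<Rightarrow> 'a set \<Rightarrow> 'a \<Rightarrow> nat" where
  "word_norm G S g =
     (LEAST k. \<exists>ws. length ws = k \<and> set ws \<subseteq> S \<and> foldr (\<otimes>\<^bsub>G\<^esub>) ws \<one>\<^bsub>G\<^esub> = g)"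

text \<open>Configurations are extensional functions, hence equal as soon as they agree on
  the carrier.\<close>

definition configurations :: "('a, 'b) monoid_scheme \<Rightarrow> nat \<Rightarrow> ('a \<Rightarrow> nat) set" where
  "configurations G n = carrier G \<rightarrow>\<^sub>E {1..n}"

definition shift :: "('a, 'b) monoid_scheme \<Rightarrow> 'a \<Rightarrow> ('a \<Rightarrow> nat) \<Rightarrow> 'a \<Rightarrow> nat" where
  "shift G g x = (\<lambda>h\<in>carrier G. x (inv\<^bsub>G\<^esub> g \<otimes>\<^bsub>G\<^esub> h))"

definition periodic :: "('a, 'b) monoid_scheme \<Rightarrow> ('a \<Rightarrow> nat) \<Rightarrow> bool" where
  "periodic G x \<longleftrightarrow> finite_index G (stabilizer G (shift G) x)"

definition color_vertices ::
    "('a, 'b) monoid_scheme \<Rightarrow> ('a \<Rightarrow> nat) \<Rightarrow> nat \<Rightarrow> 'a set" where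
  "color_vertices G x c = {a \<in> carrier G. x a = c}"

definition color_edges ::
    "('a, 'b) monoid_scheme \<Rightarrow> 'a set \<Rightarrow> nat \<Rightarrow> ('a \<Rightarrow> nat) \<Rightarrow> nat \<Rightarrow> ('a \<times> 'a) set" where
  "color_edges G S r x c =
     {(a, b). a \<in> color_vertices G x c \<and> b \<in> color_vertices G x c \<and>
              word_norm G S (inv\<^bsub>G\<^esub> a \<otimes>\<^bsub>G\<^esub> b) \<le> r}"

text \<open>Since the generating set is symmetric, so is the edge relation, and the component of a
  vertex is the set of vertices reachable from it.\<close>

definition color_components ::
    "('a, 'b) monoid_scheme \<Rightarrow> 'a set \<Rightarrow> nat \<Rightarrow> ('a \<Rightarrow> nat) \<Rightarrow> nat \<Rightarrow> 'a set set" where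
  "color_components G S r x c =
     (\<lambda>a. (color_edges G S r x c)\<^sup>* `` {a}) ` color_vertices G x c"

definition bounded_colorings ::
    "('a, 'b) monoid_scheme \<Rightarrow> 'a set \<Rightarrow> nat \<Rightarrow> nat \<Rightarrow> nat \<Rightarrow> ('a \<Rightarrow> nat) set" where
  "bounded_colorings G S n r m =
     {x \<in> configurations G n.
        \<forall>c\<in>{1..n}. \<forall>C\<in>color_components G S r x c. finite C \<and> card C \<le> m}"

text \<open>The infimum of the empty set of extended naturals is infinity.\<close>

definition pdim :: "('a, 'b) monoid_scheme \<Rightarrow> 'a set \<Rightarrow> enat" where
  "pdim G S =
     Inf {enat d | d. \<forall>r. \<exists>m. \<exists>x\<in>bounded_colorings G S (d + 1) r m. periodic G x}"

end

theory Submission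
  imports Defs
begin

text \<open>Call \<open>A\<close> \<open>d\<close>-colorable if for every finite \<open>F\<close> it has a coloring by \<open>d\<close> colors with finite-index
  stabilizer in which each monochromatic path with steps in \<open>F\<close> has its total displacement
  \<open>a\<inverse> b\<close> in a fixed finite set. Since adjacency is invariant under left translation, colorability
  passes to finite-index overgroups by pulling back along a choice of right coset representatives.
  If \<open>A = N \<langle>t\<rangle>\<close> with \<open>A / N\<close> infinite cyclic, cut \<open>A\<close> into blocks of \<open>L\<close> consecutive cosets
  \<open>N t\<^sup>k\<close> and color each block with a left translate of a coloring of \<open>N\<close>, using two disjoint palettes
  alternately; this doubles the number of colors. The new coloring is periodic because the period
  group in \<open>N\<close> can be shrunk to one that is invariant under conjugation by \<open>A\<close>, namely the
  intersection of all subgroups of \<open>N\<close> of bounded index, which itself has finite index.\<close>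

text \<open>For subgroups \<open>K\<close> inside \<open>A\<close> this is finiteness of the index.
  With right translates in place of cosets it makes sense for arbitrary sets and is monotone in
  \<open>K\<close>.\<close>

definition finitely_covers :: "('a, 'b) monoid_scheme \<Rightarrow> 'a set \<Rightarrow> 'a set \<Rightarrow> bool" where
  "finitely_covers G K A \<longleftrightarrow>
     (\<exists>T. finite T \<and> T \<subseteq> carrier G \<and> (\<forall>a\<in>A. \<exists>k\<in>K. \<exists>s\<in>T. a = k \<otimes>\<^bsub>G\<^esub> s))"

text \<open>Steps come from an arbitrary set \<open>F\<close> of displacements instead of a ball of
  the word norm, so no generating set has to be chosen for the subgroups met in the
  induction.\<close>

definition monochromatic_edges ::
    "('a, 'b) monoid_scheme \<Rightarrow> 'a set \<Rightarrow> ('a \<Rightarrow> nat) \<Rightarrow> 'a set \<Rightarrow> ('a \<times> 'a) set" where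
  "monochromatic_edges G A x F =
     {(a, b). a \<in> A \<and> b \<in> A \<and> x a = x b \<and> inv\<^bsub>G\<^esub> a \<otimes>\<^bsub>G\<^esub> b \<in> F}"

text \<open>One finite set \<open>B\<close> serves all starting points: whatever is reachable from
  \<open>a\<close> lies in the left translate of \<open>B\<close> by \<open>a\<close>, so its size
  is at most \<open>card B\<close>.\<close>

definition uniformly_bounded ::
    "('a, 'b) monoid_scheme \<Rightarrow> 'a set \<Rightarrow> ('a \<Rightarrow> nat) \<Rightarrow> 'a set \<Rightarrow> bool" where
  "uniformly_bounded G A x F \<longleftrightarrow>
     (\<exists>B. finite B \<and> B \<subseteq> carrier G \<and>
        (\<forall>a\<in>A. \<forall>b. (a, b) \<in> (monochromatic_edges G A x F)\<^sup>* \<longrightarrow> inv\<^bsub>G\<^esub> a \<otimes>\<^bsub>G\<^esub> b \<in> B))"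

definition left_periods :: "('a, 'b) monoid_scheme \<Rightarrow> 'a set \<Rightarrow> ('a \<Rightarrow> nat) \<Rightarrow> 'a set" where
  "left_periods G A x = {g \<in> A. \<forall>a\<in>A. x (g \<otimes>\<^bsub>G\<^esub> a) = x a}"

text \<open>As in \<open>pdim\<close>, the number of colors is fixed before the scale
  \<open>F\<close>, while the coloring may depend on \<open>F\<close>. Colors start at 0 here and
  are raised by one at the end.\<close>

definition colorable :: "('a, 'b) monoid_scheme \<Rightarrow> 'a set \<Rightarrow> nat \<Rightarrow> bool" where
  "colorable G A d \<longleftrightarrow>
     (\<forall>F. finite F \<longrightarrow> F \<subseteq> carrier G \<longrightarrow>
        (\<exists>x. (\<forall>a\<in>A. x a < d) \<and> finitely_covers G (left_periods G A x) A \<and>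
             uniformly_bounded G A x F))"

definition finitely_generated_subgroup :: "('a, 'b) monoid_scheme \<Rightarrow> 'a set \<Rightarrow> bool" where
  "finitely_generated_subgroup G A \<longleftrightarrow> (\<exists>S. finite S \<and> S \<subseteq> carrier G \<and> generate G S = A)"

definition index_le :: "('a, 'b) monoid_scheme \<Rightarrow> 'a set \<Rightarrow> 'a set \<Rightarrow> nat \<Rightarrow> bool" where
  "index_le G H A n \<longleftrightarrow>
     subgroup H G \<and> H \<subseteq> A \<and>
     (\<exists>T. finite T \<and> card T \<le> n \<and> T \<subseteq> carrier G \<and> (\<forall>a\<in>A. \<exists>h\<in>H. \<exists>s\<in>T. a = h \<otimes>\<^bsub>G\<^esub> s))"

text \<open>A substitute for ``finitely many subgroups of each finite index'' that passes to
  extensions without any counting.\<close>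

definition small_index_core :: "('a, 'b) monoid_scheme \<Rightarrow> 'a set \<Rightarrow> bool" where
  "small_index_core G A \<longleftrightarrow>
     (\<forall>n. \<exists>K. subgroup K G \<and> finitely_covers G K A \<and> (\<forall>H. index_le G H A n \<longrightarrow> K \<subseteq> H))"

text \<open>Integers less than \<open>L\<close> apart lie in equal or adjacent blocks of length
  \<open>L\<close>, and adjacent blocks have opposite parity.\<close>

lemma div_eq_if_near_and_same_parity:
  fixes k l L :: int
  assumes "\<bar>l - k\<bar> < L" "(k div L) mod 2 = (l div L) mod 2"
  shows "k div L = l div L"
proof -
  have L: "L > 0" using assms(1) by simp
  have "L * (k div L) \<le> k" "k < L * (k div L) + L" "L * (l div L) \<le> l" "l < L * (l div L) + L"
    using L by (simp_all add: minus_mod_eq_mult_div[symmetric] add.commute less_diff_eq)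
  then have "L * (k div L - l div L) < L * 2" "L * (l div L - k div L) < L * 2"
    using assms(1) by (simp_all add: algebra_simps)
  then have "k div L - l div L < 2" "l div L - k div L < 2"
    using L mult_less_cancel_left_pos by blast+
  moreover have "k' = l'" if "k' - l' < 2" "l' - k' < 2" "k' mod 2 = l' mod 2" for k' l' :: int
    using that by presburger
  ultimately show ?thesis using assms(2) by blast
qed

section \<open>Coverings by translates, period groups and pullback of colorings\<close>

context group
begin

lemma inv_mult_cancel [simp]:
  "\<lbrakk>a \<in> carrier G; b \<in> carrier G\<rbrakk> \<Longrightarrow> inv a \<otimes> (a \<otimes> b) = b"
  "\<lbrakk>a \<in> carrier G; b \<in> carrier G\<rbrakk> \<Longrightarrow> a \<otimes> (inv a \<otimes> b) = b"
  by (simp_all add: m_assoc[symmetric])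

lemma int_pow_add_mult:
  "\<lbrakk>t \<in> carrier G; b \<in> carrier G\<rbrakk> \<Longrightarrow> t [^] (i::int) \<otimes> (t [^] (j::int) \<otimes> b) = t [^] (i + j) \<otimes> b"
  by (simp add: int_pow_mult m_assoc)

lemma finitely_covers_mono:
  assumes "finitely_covers G K A" "K \<subseteq> K'"
  shows "finitely_covers G K' A"
  using assms unfolding finitely_covers_def by (meson subsetD)

lemma finitely_covers_trans:
  assumes "finitely_covers G K N" "finitely_covers G N A" "K \<subseteq> carrier G"
  shows "finitely_covers G K A"
proof -
  obtain T where T: "finite T" "T \<subseteq> carrier G" "\<forall>a\<in>N. \<exists>k\<in>K. \<exists>s\<in>T. a = k \<otimes> s"
    using assms(1) unfolding finitely_covers_def by blast
  obtain U where U: "finite U" "U \<subseteq> carrier G" "\<forall>a\<in>A. \<exists>k\<in>N. \<exists>s\<in>U. a = k \<otimes> s"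
    using assms(2) unfolding finitely_covers_def by blast
  have "\<exists>k\<in>K. \<exists>s\<in>(\<lambda>(s, u). s \<otimes> u) ` (T \<times> U). a = k \<otimes> s" if a: "a \<in> A" for a
  proof -
    obtain v u where v: "v \<in> N" "u \<in> U" "a = v \<otimes> u" using U(3) a by blast
    obtain k s where k: "k \<in> K" "s \<in> T" "v = k \<otimes> s" using T(3) v(1) by blast
    have "a = k \<otimes> (s \<otimes> u)"
      using v k T(2) U(2) assms(3) by (auto simp: m_assoc subset_iff)
    then show ?thesis using k v by force
  qed
  moreover have "(\<lambda>(s, u). s \<otimes> u) ` (T \<times> U) \<subseteq> carrier G" using T U by auto
  ultimately show ?thesis
    unfolding finitely_covers_def using T(1) U(1) by (intro exI[of _ "(\<lambda>(s, u). s \<otimes> u) ` (T \<times> U)"]) auto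
qed

lemma subgroup_left_periods:
  assumes "subgroup A G"
  shows "subgroup (left_periods G A x) G"
proof
  interpret A: subgroup A G by fact
  show "left_periods G A x \<subseteq> carrier G" unfolding left_periods_def by auto
  show "\<one> \<in> left_periods G A x" unfolding left_periods_def by auto
  show "g \<otimes> h \<in> left_periods G A x"
    if "g \<in> left_periods G A x" "h \<in> left_periods G A x" for g h
    using that unfolding left_periods_def by (auto simp: m_assoc)
  show "inv g \<in> left_periods G A x" if g: "g \<in> left_periods G A x" for g
  proof -
    have "x (inv g \<otimes> a) = x a" if "a \<in> A" for a
    proof -
      have "x (g \<otimes> (inv g \<otimes> a)) = x (inv g \<otimes> a)"
        using g that unfolding left_periods_def by (auto simp del: inv_mult_cancel)
      moreover have "g \<otimes> (inv g \<otimes> a) = a" using g that unfolding left_periods_def by auto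
      ultimately show ?thesis by simp
    qed
    then show ?thesis using g unfolding left_periods_def by auto
  qed
qed

text \<open>Pulling a coloring back along \<open>p\<close>. Since \<open>\<beta>\<close> is constant along the edges and the edge
  relation is left invariant, \<open>\<beta>\<close> disappears from \<open>inv a \<otimes> b\<close>, and \<open>q\<close> only perturbs it by
  finitely many elements.\<close>

lemma uniformly_bounded_pullback:
  fixes x y :: "'a \<Rightarrow> nat"
  assumes "A \<subseteq> carrier G" "C \<subseteq> carrier G" "finite T" "T \<subseteq> carrier G" "F \<subseteq> carrier G"
    and dec: "\<And>c. c \<in> C \<Longrightarrow> p c \<in> A \<and> q c \<in> T \<and> \<beta> c \<in> carrier G \<and> \<beta> c \<otimes> p c \<otimes> q c = c"
    and edge: "\<And>a b. \<lbrakk>a \<in> C; b \<in> C; y a = y b; inv a \<otimes> b \<in> F\<rbrakk> \<Longrightarrow> \<beta> a = \<beta> b \<and> x (p a) = x (p b)"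
    and bd: "uniformly_bounded G A x ((\<lambda>(s, f, s'). s \<otimes> f \<otimes> inv s') ` (T \<times> F \<times> T))"
  shows "uniformly_bounded G C y F"
proof -
  let ?F = "(\<lambda>(s, f, s'). s \<otimes> f \<otimes> inv s') ` (T \<times> F \<times> T)"
  let ?E = "monochromatic_edges G A x ?F"
  obtain B where B: "finite B" "B \<subseteq> carrier G"
      "\<And>a b. \<lbrakk>a \<in> A; (a, b) \<in> ?E\<^sup>*\<rbrakk> \<Longrightarrow> inv a \<otimes> b \<in> B"
    using bd unfolding uniformly_bounded_def by blast
  have inG: "p c \<in> carrier G" "q c \<in> carrier G" "\<beta> c \<in> carrier G" if "c \<in> C" for c
    using dec[OF that] assms(1,4) by auto
  have edge_step: "(p a, p b) \<in> ?E \<and> \<beta> a = \<beta> b" if "(a, b) \<in> monochromatic_edges G C y F" for a b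
  proof -
    have ab: "a \<in> C" "b \<in> C" "y a = y b" "inv a \<otimes> b \<in> F"
      using that unfolding monochromatic_edges_def by auto
    have e: "\<beta> a = \<beta> b" "x (p a) = x (p b)" using edge[OF ab] by auto
    have "p c = inv (\<beta> c) \<otimes> c \<otimes> inv (q c)" if "c \<in> C" for c
    proof -
      have "inv (\<beta> c) \<otimes> (\<beta> c \<otimes> p c \<otimes> q c) \<otimes> inv (q c) = p c"
        using inG[OF that] by (simp add: m_assoc)
      then show ?thesis using dec[OF that] by simp
    qed
    then have "inv (p a) \<otimes> p b = q a \<otimes> (inv a \<otimes> b) \<otimes> inv (q b)"
      using ab inG[OF ab(1)] inG[OF ab(2)] assms(2) e
      by (simp add: m_assoc inv_mult_group subset_iff)
    then have "inv (p a) \<otimes> p b \<in> ?F" using dec ab by force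
    then show ?thesis using e dec ab unfolding monochromatic_edges_def by auto
  qed
  let ?B = "(\<lambda>(s, f, s'). inv s \<otimes> f \<otimes> s') ` (T \<times> B \<times> T)"
  have "inv a \<otimes> b \<in> ?B" if a: "a \<in> C" and ab: "(a, b) \<in> (monochromatic_edges G C y F)\<^sup>*" for a b
  proof -
    have "(p a, p b) \<in> ?E\<^sup>* \<and> \<beta> a = \<beta> b \<and> b \<in> C"
      using ab
    proof (induction rule: rtrancl_induct)
      case base
      then show ?case using a by simp
    next
      case (step b c)
      have "c \<in> C" using step.hyps(2) unfolding monochromatic_edges_def by auto
      then show ?case using step.IH edge_step[OF step.hyps(2)] by (auto intro: rtrancl_into_rtrancl)
    qed
    then have h: "inv (p a) \<otimes> p b \<in> B" "\<beta> a = \<beta> b" "b \<in> C" using B(3) dec[OF a] by auto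
    have "inv a \<otimes> b = inv (\<beta> a \<otimes> p a \<otimes> q a) \<otimes> (\<beta> a \<otimes> p b \<otimes> q b)"
      using dec[OF a] dec[OF h(3)] h(2) by metis
    also have "\<dots> = inv (q a) \<otimes> (inv (p a) \<otimes> p b) \<otimes> q b"
      using inG[OF a] inG[OF h(3)] by (simp add: m_assoc inv_mult_group)
    finally show ?thesis using h(1) dec[OF a] dec[OF h(3)] by force
  qed
  moreover have "finite ?B" "?B \<subseteq> carrier G" using B(1,2) assms(3,4) by (auto simp: subset_iff)
  ultimately show ?thesis unfolding uniformly_bounded_def by blast
qed

text \<open>Split \<open>a\<close> as \<open>p a \<otimes> q a\<close> with \<open>p a\<close> in
  \<open>N\<close> and \<open>q a\<close> one of finitely many representatives, and give
  \<open>a\<close> the color of \<open>p a\<close>. Since \<open>q\<close> is invariant under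
  \<open>N\<close>, every period of the old coloring remains a period.\<close>

lemma colorable_finite_overgroup:
  assumes "subgroup N G" "subgroup A G" "finitely_covers G N A" "N \<subseteq> A" "colorable G N d"
  shows "colorable G A d"
  unfolding colorable_def
proof (intro allI impI)
  fix F assume F: "finite F" "F \<subseteq> carrier G"
  interpret N: subgroup N G by fact
  interpret A: subgroup A G by fact
  obtain T where T: "finite T" "T \<subseteq> carrier G" "\<forall>a\<in>A. \<exists>k\<in>N. \<exists>s\<in>T. a = k \<otimes> s"
    using assms(3) unfolding finitely_covers_def by blast
  \<comment> \<open>Replacing \<open>a\<close> and \<open>b\<close> by \<open>p a\<close> and
    \<open>p b\<close> puts representatives on both sides of a displacement, so the coloring of
    \<open>N\<close> is taken for this larger step set.\<close>
  let ?F = "(\<lambda>(s, f, s'). s \<otimes> f \<otimes> inv s') ` (T \<times> F \<times> T)"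
  have "finite ?F" "?F \<subseteq> carrier G" using T(1,2) F by (auto simp: subset_iff)
  then obtain x where x: "\<forall>a\<in>N. x a < d" "finitely_covers G (left_periods G N x) N"
      "uniformly_bounded G N x ?F"
    using assms(5) unfolding colorable_def by blast
  \<comment> \<open>The predicate under \<open>SOME\<close> depends only on the coset of
    \<open>N\<close> containing \<open>a\<close>; hence equal cosets get the same
    representative.\<close>
  define q where "q a = (SOME t. t \<in> T \<and> a \<otimes> inv t \<in> N)" for a
  define p where "p a = a \<otimes> inv (q a)" for a
  have q: "q a \<in> T \<and> a \<otimes> inv (q a) \<in> N" if a: "a \<in> A" for a
  proof -
    obtain k s where "k \<in> N" "s \<in> T" "a = k \<otimes> s" using T(3) a by meson
    moreover have "k \<otimes> s \<otimes> inv s = k"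
      using T(2) \<open>k \<in> N\<close> \<open>s \<in> T\<close> by (simp add: m_assoc subset_iff)
    ultimately show ?thesis
      using someI[of "\<lambda>t. t \<in> T \<and> a \<otimes> inv t \<in> N" s] unfolding q_def by simp
  qed
  have p: "p a \<in> N" "\<one> \<otimes> p a \<otimes> q a = a" if "a \<in> A" for a
    using q[OF that] that T(2) unfolding p_def by (auto simp: m_assoc subset_iff)
  have q_equi: "q (u \<otimes> a) = q a" if u: "u \<in> N" and a: "a \<in> A" for u a
  proof -
    have "u \<otimes> a \<otimes> inv t \<in> N \<longleftrightarrow> a \<otimes> inv t \<in> N" if "t \<in> T" for t
    proof
      assume "u \<otimes> a \<otimes> inv t \<in> N"
      then have "inv u \<otimes> (u \<otimes> a \<otimes> inv t) \<in> N" using u by auto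
      then show "a \<otimes> inv t \<in> N" using u a T(2) that by (auto simp: m_assoc subset_iff)
    next
      assume "a \<otimes> inv t \<in> N"
      then have "u \<otimes> (a \<otimes> inv t) \<in> N" using u by auto
      then show "u \<otimes> a \<otimes> inv t \<in> N" using u a T(2) that by (auto simp: m_assoc subset_iff)
    qed
    then have "(\<lambda>t. t \<in> T \<and> u \<otimes> a \<otimes> inv t \<in> N) = (\<lambda>t. t \<in> T \<and> a \<otimes> inv t \<in> N)"
      by blast
    then show ?thesis unfolding q_def by simp
  qed
  have "uniformly_bounded G A (\<lambda>a. x (p a)) F"
    by (rule uniformly_bounded_pullback[where A = N and T = T and p = p and q = q
          and \<beta> = "\<lambda>_. \<one>" and x = x])
       (use T(1,2) F q p x(3) in auto)
  moreover have "left_periods G N x \<subseteq> left_periods G A (\<lambda>a. x (p a))"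
  proof
    fix u assume u: "u \<in> left_periods G N x"
    then have uN: "u \<in> N" by (simp add: left_periods_def)
    have "x (p (u \<otimes> a)) = x (p a)" if "a \<in> A" for a
    proof -
      have "p (u \<otimes> a) = u \<otimes> p a"
        using q_equi[OF uN that] that uN q[OF that] subsetD[OF T(2)]
        unfolding p_def by (simp add: m_assoc)
      then show ?thesis using u p(1)[OF that] by (simp add: left_periods_def)
    qed
    then show "u \<in> left_periods G A (\<lambda>a. x (p a))"
      using uN assms(4) by (auto simp: left_periods_def)
  qed
  moreover have "finitely_covers G (left_periods G N x) A"
    using finitely_covers_trans[OF x(2) assms(3)] subgroup.subset[OF subgroup_left_periods[OF assms(1)]]
    by simp
  ultimately show "\<exists>x. (\<forall>a\<in>A. x a < d) \<and> finitely_covers G (left_periods G A x) A \<and>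
      uniformly_bounded G A x F"
    using x(1) p(1) finitely_covers_mono
    by (intro exI[of _ "\<lambda>a. x (p a)"] conjI ballI) simp_all
qed

section \<open>Subgroups of bounded index\<close>

lemma index_le_conj:
  assumes "index_le G H N n" "a \<in> carrier G" "\<And>v. v \<in> N \<Longrightarrow> a \<otimes> v \<otimes> inv a \<in> N"
    "\<And>v. v \<in> N \<Longrightarrow> inv a \<otimes> v \<otimes> a \<in> N" "N \<subseteq> carrier G"
  shows "index_le G ((\<lambda>h. a \<otimes> h \<otimes> inv a) ` H) N n"
proof -
  have H: "subgroup H G" "H \<subseteq> N" using assms(1) unfolding index_le_def by auto
  obtain T where T: "finite T" "card T \<le> n" "T \<subseteq> carrier G" "\<forall>v\<in>N. \<exists>h\<in>H. \<exists>s\<in>T. v = h \<otimes> s"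
    using assms(1) unfolding index_le_def by blast
  let ?c = "\<lambda>h. a \<otimes> h \<otimes> inv a"
  interpret H: subgroup H G by fact
  have "subgroup (?c ` H) G"
  proof
    show "?c ` H \<subseteq> carrier G" using assms(2) by auto
    have "\<one> = ?c \<one>" using assms(2) by simp
    then show "\<one> \<in> ?c ` H" by (rule image_eqI) simp
    fix g h assume "g \<in> ?c ` H"
    then obtain g' where g: "g' \<in> H" "g = ?c g'" by blast
    have "inv g = ?c (inv g')" using g assms(2) by (simp add: inv_mult_group m_assoc)
    then show "inv g \<in> ?c ` H" using g by blast
    assume "h \<in> ?c ` H"
    then obtain h' where h: "h' \<in> H" "h = ?c h'" by blast
    have "g \<otimes> h = ?c (g' \<otimes> h')" using g h assms(2) by (simp add: m_assoc)
    then show "g \<otimes> h \<in> ?c ` H" using g h by blast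
  qed
  moreover have "\<exists>h\<in>?c ` H. \<exists>s\<in>?c ` T. v = h \<otimes> s" if vN: "v \<in> N" for v
  proof -
    obtain h s where hs: "h \<in> H" "s \<in> T" "inv a \<otimes> v \<otimes> a = h \<otimes> s"
      using T(4) assms(4)[OF vN] by meson
    have v: "v \<in> carrier G" "s \<in> carrier G" using vN assms(5) T(3) hs(2) by auto
    have "v = a \<otimes> (inv a \<otimes> v \<otimes> a) \<otimes> inv a" using assms(2) v by (simp add: m_assoc)
    also have "\<dots> = ?c h \<otimes> ?c s" unfolding hs(3) using assms(2) v hs(1) by (simp add: m_assoc)
    finally show ?thesis using hs by blast
  qed
  moreover have "?c ` H \<subseteq> N" using H assms(3) by auto
  moreover have "card (?c ` T) \<le> n" using T card_image_le le_trans by blast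
  moreover have "?c ` T \<subseteq> carrier G" using T assms(2) by auto
  ultimately show ?thesis unfolding index_le_def using T(1) by blast
qed

text \<open>Take the intersection of all subgroups of \<open>N\<close> of index at most
  \<open>n\<close>. Conjugation by an element normalizing \<open>N\<close> permutes this family, and
  \<open>small_index_core\<close> supplies a finitely covering subgroup below every member.\<close>

lemma invariant_subgroup_of_finite_index:
  assumes "small_index_core G N" "subgroup N G" "subgroup H G" "H \<subseteq> N" "finitely_covers G H N"
  shows "\<exists>K. subgroup K G \<and> K \<subseteq> H \<and> finitely_covers G K N \<and>
     (\<forall>a\<in>carrier G. (\<forall>v\<in>N. a \<otimes> v \<otimes> inv a \<in> N \<and> inv a \<otimes> v \<otimes> a \<in> N) \<longrightarrow>
        (\<forall>u\<in>K. a \<otimes> u \<otimes> inv a \<in> K))"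
proof -
  \<comment> \<open>\<open>n\<close> is the size of any finite covering set for \<open>H\<close>.
    This puts \<open>H\<close> into the family, which makes the family nonempty and its intersection
    a subset of \<open>H\<close>.\<close>
  obtain n where n: "index_le G H N n"
    using assms unfolding finitely_covers_def index_le_def by blast
  define K where "K = \<Inter>{H. index_le G H N n}"
  obtain K0 where K0: "subgroup K0 G" "finitely_covers G K0 N" "\<And>H. index_le G H N n \<Longrightarrow> K0 \<subseteq> H"
    using assms(1) unfolding small_index_core_def by metis
  have "subgroup K G" unfolding K_def
    by (rule subgroups_Inter) (use n in \<open>auto simp: index_le_def\<close>)
  moreover have "K \<subseteq> H" using n unfolding K_def by blast
  moreover have "finitely_covers G K N"
    using K0 finitely_covers_mono unfolding K_def by (metis Inter_greatest mem_Collect_eq)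
  moreover have "a \<otimes> u \<otimes> inv a \<in> K"
    if a: "a \<in> carrier G" and conj: "\<forall>v\<in>N. a \<otimes> v \<otimes> inv a \<in> N \<and> inv a \<otimes> v \<otimes> a \<in> N"
      and u: "u \<in> K" for a u
    unfolding K_def
  proof (rule InterI, clarify)
    fix H' assume H': "index_le G H' N n"
    \<comment> \<open>The conjugate of \<open>H'\<close> by \<open>inv a\<close> belongs to the
      family too, so it contains \<open>u\<close>; conjugating back places
      \<open>a \<otimes> u \<otimes> inv a\<close> in \<open>H'\<close>.\<close>
    have "index_le G ((\<lambda>h. inv a \<otimes> h \<otimes> inv (inv a)) ` H') N n"
      by (rule index_le_conj[OF H']) (use a conj subgroup.subset[OF assms(2)] in auto)
    then have "u \<in> (\<lambda>h. inv a \<otimes> h \<otimes> inv (inv a)) ` H'" using u unfolding K_def by blast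
    then obtain h where h: "h \<in> H'" "u = inv a \<otimes> h \<otimes> a" using a by auto
    have "h \<in> carrier G" using h H' subgroup.subset unfolding index_le_def by blast
    then have "a \<otimes> u \<otimes> inv a = h" using a h by (simp add: m_assoc)
    then show "a \<otimes> u \<otimes> inv a \<in> H'" using h by simp
  qed
  ultimately show ?thesis by (intro exI[of _ K] conjI ballI impI) simp_all
qed

text \<open>Only the translates of \<open>H\<close> that meet \<open>N\<close> matter. Choose in
  each of them a new representative \<open>f s\<close> from \<open>N\<close>: if \<open>v\<close> in
  \<open>N\<close> lies in the same translate, then \<open>v \<otimes> inv (f s)\<close> lies in
  both \<open>H\<close> and \<open>N\<close>.\<close>

lemma index_le_inter:
  assumes "index_le G H A n" "subgroup N G" "N \<subseteq> A"
  shows "index_le G (H \<inter> N) N n"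
proof -
  have H: "subgroup H G" using assms(1) unfolding index_le_def by blast
  obtain T where T: "finite T" "card T \<le> n" "T \<subseteq> carrier G" "\<forall>a\<in>A. \<exists>h\<in>H. \<exists>s\<in>T. a = h \<otimes> s"
    using assms(1) unfolding index_le_def by blast
  define P where "P s v \<longleftrightarrow> v \<in> N \<and> (\<exists>h\<in>H. v = h \<otimes> s)" for s v
  define U where "U = {s \<in> T. \<exists>v. P s v}"
  define f where "f s = (SOME v. P s v)" for s
  have f: "P s (f s)" if "s \<in> U" for s
    using that someI_ex[of "P s"] unfolding U_def f_def by simp
  have U: "finite U" "card U \<le> n"
    using T(1,2) card_mono[of T U] unfolding U_def by auto
  have "card (f ` U) \<le> n" using card_image_le[OF U(1), of f] U(2) by linarith
  moreover have "finite (f ` U)" using U(1) by simp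
  moreover have "f ` U \<subseteq> carrier G"
    using f subgroup.mem_carrier[OF assms(2)] unfolding P_def by blast
  moreover have "\<exists>h\<in>H \<inter> N. \<exists>s\<in>f ` U. v = h \<otimes> s" if v: "v \<in> N" for v
  proof -
    obtain h s where hs: "h \<in> H" "s \<in> T" "v = h \<otimes> s" using T(4) v assms(3) by (meson subsetD)
    then have s: "s \<in> U" using v unfolding U_def P_def by blast
    obtain g where g: "g \<in> H" "f s = g \<otimes> s" "f s \<in> N" using f[OF s] unfolding P_def by blast
    have c: "h \<in> carrier G" "g \<in> carrier G" "s \<in> carrier G" "v \<in> carrier G" "f s \<in> carrier G"
      using hs g T(3) v subgroup.mem_carrier[OF H] subgroup.mem_carrier[OF assms(2)] by auto
    have "v \<otimes> inv (f s) = h \<otimes> inv g"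
      using c unfolding hs(3) g(2) by (simp add: m_assoc inv_mult_group)
    moreover have "h \<otimes> inv g \<in> H"
      using hs(1) g(1) subgroup.m_closed[OF H] subgroup.m_inv_closed[OF H] by blast
    moreover have "v \<otimes> inv (f s) \<in> N"
      using v g(3) subgroup.m_closed[OF assms(2)] subgroup.m_inv_closed[OF assms(2)] by blast
    moreover have "v = v \<otimes> inv (f s) \<otimes> f s" using c by (simp add: m_assoc)
    ultimately show ?thesis using s by (metis IntI imageI)
  qed
  ultimately show ?thesis
    unfolding index_le_def using subgroups_Inter_pair[OF H assms(2)] by blast
qed

text \<open>By the pigeonhole principle two of the \<open>n + 1\<close> powers of \<open>t\<close>
  with exponents \<open>0\<close> to \<open>n\<close> lie in one translate of \<open>H\<close>. So
  \<open>H\<close> contains a power with exponent between 1 and \<open>n\<close>, which divides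
  \<open>fact n\<close>. The resulting exponent does not depend on \<open>H\<close>.\<close>

lemma index_le_pow_fact:
  assumes "index_le G H A n" "subgroup A G" "t \<in> A"
  shows "t [^] int (fact n) \<in> H"
proof -
  have H: "subgroup H G" using assms(1) unfolding index_le_def by blast
  have t: "t \<in> carrier G" using subgroup.mem_carrier[OF assms(2,3)] .
  obtain T where T: "finite T" "card T \<le> n" "T \<subseteq> carrier G" "\<forall>a\<in>A. \<exists>h\<in>H. \<exists>s\<in>T. a = h \<otimes> s"
    using assms(1) unfolding index_le_def by blast
  have "\<forall>i. \<exists>s h. s \<in> T \<and> h \<in> H \<and> t [^] int i = h \<otimes> s"
    using T(4) subgroup_int_pow_closed[OF assms(2,3)] by meson
  then obtain c h where ch: "\<And>i. c i \<in> T" "\<And>i. h i \<in> H" "\<And>i. t [^] int i = h i \<otimes> c i"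
    by metis
  have "card (c ` {..n}) \<le> n" using card_mono[OF T(1), of "c ` {..n}"] ch(1) T(2) by fastforce
  then have "\<not> inj_on c {..n}" using card_image[of c "{..n}"] by auto
  then obtain i j where ij: "i < j" "j \<le> n" "c i = c j"
    unfolding inj_on_def by (metis atMost_iff linorder_neqE_nat)
  have cH: "h k \<in> carrier G" "c k \<in> carrier G" for k
    using ch T(3) subgroup.mem_carrier[OF H] by auto
  have "t [^] (int j - int i) = t [^] int j \<otimes> inv (t [^] int i)"
    using int_pow_diff[OF t] .
  also have "\<dots> = h j \<otimes> inv (h i)"
    unfolding ch(3) ij(3) using cH by (simp add: m_assoc inv_mult_group)
  also have "\<dots> \<in> H" using ch(2) subgroup.m_closed[OF H] subgroup.m_inv_closed[OF H] by blast
  finally have tH: "t [^] (int j - int i) \<in> H" .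
  have "j - i dvd fact n" using ij by (intro dvd_fact) auto
  then obtain m where "fact n = (j - i) * m" by blast
  then have "int (fact n) = (int j - int i) * int m" using ij by (simp add: of_nat_diff)
  then show ?thesis using subgroup_int_pow_closed[OF H tH, of "int m"] t by (simp add: int_pow_pow)
qed

end

section \<open>Extensions with cyclic quotient\<close>

locale cyclic_extension = group G for G :: "('a, 'b) monoid_scheme" (structure) +
  fixes N A :: "'a set" and t :: 'a
  assumes subgroup_N: "subgroup N G" and subgroup_A: "subgroup A G" and N_le_A: "N \<subseteq> A"
    and t_in_A: "t \<in> A"
    and conj_closed: "\<lbrakk>a \<in> A; v \<in> N\<rbrakk> \<Longrightarrow> a \<otimes> v \<otimes> inv a \<in> N"
    and cyclic_quotient: "a \<in> A \<Longrightarrow> \<exists>k::int. t [^] (- k) \<otimes> a \<in> N"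
begin

lemma A_carrier [simp]: "a \<in> A \<Longrightarrow> a \<in> carrier G"
  using subgroup_A by (rule subgroup.mem_carrier)

lemma N_carrier [simp]: "v \<in> N \<Longrightarrow> v \<in> carrier G"
  using subgroup_N by (rule subgroup.mem_carrier)

lemma t_carrier [simp]: "t \<in> carrier G"
  using t_in_A by simp

lemma t_pow_in_A: "t [^] (k::int) \<in> A"
  using subgroup_int_pow_closed[OF subgroup_A t_in_A] .

lemma conj_closed': "\<lbrakk>a \<in> A; v \<in> N\<rbrakk> \<Longrightarrow> inv a \<otimes> v \<otimes> a \<in> N"
  using conj_closed[of "inv a" v] subgroup.m_inv_closed[OF subgroup_A] by simp

lemma conj_t_pow: "v \<in> N \<Longrightarrow> t [^] (k::int) \<otimes> v \<otimes> t [^] (- k) \<in> N"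
  using conj_closed[OF t_pow_in_A] by (simp add: int_pow_neg)

text \<open>Division with remainder by \<open>M\<close> leaves a power of \<open>t\<close> with
  exponent in \<open>{0..<M}\<close>, which goes into the finite set. Hence a subgroup containing
  \<open>K\<close> and \<open>t [^] M\<close> finitely covers \<open>A\<close>.\<close>

lemma covering_by_powers:
  assumes "finitely_covers G K N" "K \<subseteq> N" "M > 0"
  obtains T where "finite T" "T \<subseteq> carrier G"
    "\<And>a. a \<in> A \<Longrightarrow> \<exists>(j::int) u s. u \<in> K \<and> s \<in> T \<and> a = t [^] (M * j) \<otimes> u \<otimes> s"
proof -
  obtain T where T: "finite T" "T \<subseteq> carrier G" "\<forall>a\<in>N. \<exists>k\<in>K. \<exists>s\<in>T. a = k \<otimes> s"
    using assms(1) unfolding finitely_covers_def by blast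
  let ?T = "(\<lambda>(s, i). s \<otimes> t [^] i) ` (T \<times> {0..<M})"
  have "\<exists>(j::int) u s. u \<in> K \<and> s \<in> ?T \<and> a = t [^] (M * j) \<otimes> u \<otimes> s" if a: "a \<in> A" for a
  proof -
    obtain k :: int where k: "t [^] (- k) \<otimes> a \<in> N" using cyclic_quotient[OF a] by blast
    define i where "i = k mod M"
    define j where "j = k div M"
    have kij: "k = M * j + i" unfolding i_def j_def by simp
    have i: "i \<in> {0..<M}" using assms(3) unfolding i_def by simp
    \<comment> \<open>To bring \<open>t [^] i\<close> to the far right, the part of \<open>a\<close>
      in \<open>N\<close> is conjugated by it; the covering of \<open>N\<close> is applied to this
      conjugate.\<close>
    obtain u s where us: "u \<in> K" "s \<in> T" "t [^] i \<otimes> (t [^] (- k) \<otimes> a) \<otimes> t [^] (- i) = u \<otimes> s"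
      using T(3) conj_t_pow[OF k, of i] by meson
    have c: "u \<in> carrier G" "s \<in> carrier G" "a \<in> carrier G" using us T(2) assms(2) a by auto
    have "a = t [^] (M * j) \<otimes> (t [^] i \<otimes> (t [^] (- k) \<otimes> a) \<otimes> t [^] (- i)) \<otimes> t [^] i"
      using c by (simp add: m_assoc int_pow_add_mult flip: int_pow_mult) (simp add: kij)
    also have "\<dots> = t [^] (M * j) \<otimes> u \<otimes> (s \<otimes> t [^] i)"
      unfolding us(3) using c by (simp add: m_assoc)
    finally show ?thesis using us i by blast
  qed
  moreover have "finite ?T" using T(1) by simp
  moreover have "?T \<subseteq> carrier G" using T(2) by (auto simp: subset_iff)
  ultimately show thesis using that by blast
qed

text \<open>This is the case of a finite quotient: multiples of the exponent \<open>k\<close> stay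
  in \<open>N\<close>, so only finitely many powers of \<open>t\<close> are needed as
  representatives.\<close>

lemma finitely_covers_torsion:
  assumes "t [^] (k::int) \<in> N" "k \<noteq> 0"
  shows "finitely_covers G N A"
proof -
  have N: "finitely_covers G N N"
    unfolding finitely_covers_def by (rule exI[of _ "{\<one>}"]) force
  have k: "\<bar>k\<bar> > 0" using assms(2) by simp
  obtain T where T: "finite T" "T \<subseteq> carrier G"
    "\<And>a. a \<in> A \<Longrightarrow> \<exists>(j::int) u s. u \<in> N \<and> s \<in> T \<and> a = t [^] (\<bar>k\<bar> * j) \<otimes> u \<otimes> s"
    using covering_by_powers[OF N subset_refl k] by metis
  have "t [^] (\<bar>k\<bar> * j) \<in> N" for j
  proof -
    \<comment> \<open>The factor \<open>sgn k\<close> turns powers of \<open>t [^] k\<close> into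
      powers of \<open>t [^] \<bar>k\<bar>\<close>.\<close>
    have "(t [^] k) [^] (sgn k * j) \<in> N" using subgroup_int_pow_closed[OF subgroup_N assms(1)] .
    then show ?thesis by (simp add: int_pow_pow abs_sgn mult.assoc)
  qed
  then have "t [^] (\<bar>k\<bar> * j) \<otimes> u \<in> N" if "u \<in> N" for j u
    using subgroup.m_closed[OF subgroup_N] that by blast
  then show ?thesis unfolding finitely_covers_def using T by metis
qed

text \<open>A subgroup \<open>H\<close> of index at most \<open>n\<close> in \<open>A\<close>
  contains \<open>t [^] int (fact n)\<close> and meets \<open>N\<close> in index at most
  \<open>n\<close>, hence contains the core \<open>K\<close> of \<open>N\<close>. The core of
  \<open>A\<close> can therefore be generated by \<open>K\<close> and this one power.\<close>

lemma small_index_core_extension: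
  assumes "small_index_core G N"
  shows "small_index_core G A"
  unfolding small_index_core_def
proof
  fix n
  \<comment> \<open>With \<open>Suc n\<close> in place of \<open>n\<close>, the group
    \<open>N\<close> itself is among the subgroups considered even for \<open>n = 0\<close>, which
    gives \<open>K \<subseteq> N\<close>.\<close>
  obtain K where K: "subgroup K G" "finitely_covers G K N"
    "\<And>H. index_le G H N (Suc n) \<Longrightarrow> K \<subseteq> H"
    using assms unfolding small_index_core_def by metis
  have "index_le G N N (Suc n)"
    unfolding index_le_def using subgroup_N by (auto intro!: exI[of _ "{\<one>}"])
  then have KN: "K \<subseteq> N" using K(3) by simp
  have M: "int (fact n) > 0" by simp
  obtain T where T: "finite T" "T \<subseteq> carrier G"
    "\<And>a. a \<in> A \<Longrightarrow> \<exists>(j::int) u s. u \<in> K \<and> s \<in> T \<and> a = t [^] (int (fact n) * j) \<otimes> u \<otimes> s"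
    using covering_by_powers[OF K(2) KN M] by metis
  define L where "L = generate G (insert (t [^] int (fact n)) K)"
  have gen_in: "insert (t [^] int (fact n)) K \<subseteq> carrier G" using KN by auto
  have L: "subgroup L G" unfolding L_def by (rule generate_is_subgroup[OF gen_in])
  have L_gen: "t [^] int (fact n) \<in> L" "u \<in> K \<Longrightarrow> u \<in> L" for u
    unfolding L_def by (auto intro: generate.incl)
  have "t [^] (int (fact n) * j) \<otimes> u \<in> L" if "u \<in> K" for j u
  proof -
    have "(t [^] int (fact n)) [^] j \<in> L" using subgroup_int_pow_closed[OF L L_gen(1)] .
    then show ?thesis using L_gen(2)[OF that] subgroup.m_closed[OF L] by (simp add: int_pow_pow)
  qed
  then have "finitely_covers G L A" unfolding finitely_covers_def using T by metis
  moreover have "L \<subseteq> H" if H: "index_le G H A n" for H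
  proof -
    have "index_le G (H \<inter> N) N n" by (rule index_le_inter[OF H subgroup_N N_le_A])
    then have "index_le G (H \<inter> N) N (Suc n)" unfolding index_le_def using le_SucI by blast
    then have "K \<subseteq> H" using K(3) by blast
    moreover have "t [^] int (fact n) \<in> H" by (rule index_le_pow_fact[OF H subgroup_A t_in_A])
    moreover have "subgroup H G" using H unfolding index_le_def by blast
    ultimately show ?thesis unfolding L_def by (intro generate_subgroup_incl) auto
  qed
  ultimately show "\<exists>K. subgroup K G \<and> finitely_covers G K A \<and> (\<forall>H. index_le G H A n \<longrightarrow> K \<subseteq> H)"
    using L by (intro exI[of _ L]) simp
qed

lemma finitely_generated_extension:
  assumes "finitely_generated_subgroup G N"
  shows "finitely_generated_subgroup G A"
proof -
  obtain S where S: "finite S" "S \<subseteq> carrier G" "generate G S = N"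
    using assms unfolding finitely_generated_subgroup_def by blast
  let ?S = "insert t S"
  have S': "?S \<subseteq> carrier G" using S(2) by simp
  have sub: "subgroup (generate G ?S) G" by (rule generate_is_subgroup[OF S'])
  have "?S \<subseteq> A" using generate.incl[of _ S G] S(3) N_le_A t_in_A by auto
  then have "generate G ?S \<subseteq> A" by (rule generate_subgroup_incl[OF _ subgroup_A])
  moreover have "a \<in> generate G ?S" if a: "a \<in> A" for a
  proof -
    obtain k :: int where "t [^] (- k) \<otimes> a \<in> N" using cyclic_quotient[OF a] by blast
    then have "t [^] (- k) \<otimes> a \<in> generate G ?S" using S(3) mono_generate[of S ?S] by blast
    moreover have "t [^] k \<in> generate G ?S"
      using subgroup_int_pow_closed[OF sub] by (simp add: generate.incl)
    ultimately have "t [^] k \<otimes> (t [^] (- k) \<otimes> a) \<in> generate G ?S"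
      using subgroup.m_closed[OF sub] by blast
    then show ?thesis using a by (simp add: int_pow_add_mult)
  qed
  ultimately show ?thesis unfolding finitely_generated_subgroup_def using S(1) S' by blast
qed

section \<open>Infinite cyclic quotients and the height homomorphism\<close>

definition height :: "'a \<Rightarrow> int" where
  "height a = (THE k. t [^] (- k) \<otimes> a \<in> N)"

context
  assumes torsion_free: "\<And>k::int. t [^] k \<in> N \<Longrightarrow> k = 0"
begin

text \<open>Two candidates \<open>k\<close> and \<open>l\<close> for the height give
  \<open>t [^] (l - k)\<close> in \<open>N\<close>, so they agree when no nontrivial power of
  \<open>t\<close> lies in \<open>N\<close>.\<close>

lemma height_eqI:
  assumes "a \<in> A" "t [^] (- k) \<otimes> a \<in> N"
  shows "height a = k"
  unfolding height_def
proof (rule the_equality[of _ k])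
  fix l :: int assume l: "t [^] (- l) \<otimes> a \<in> N"
  have "t [^] (- k) \<otimes> a \<otimes> inv (t [^] (- l) \<otimes> a) = t [^] (- k) \<otimes> t [^] l"
    using assms(1) by (simp add: inv_mult_group m_assoc int_pow_neg)
  also have "\<dots> = t [^] (l - k)" by (simp flip: int_pow_mult)
  finally have "t [^] (l - k) \<in> N"
    using assms(2) l subgroup.m_closed[OF subgroup_N] subgroup.m_inv_closed[OF subgroup_N] by metis
  then show "l = k" using torsion_free by fastforce
qed (rule assms(2))

lemma height_in_N:
  assumes "a \<in> A"
  shows "t [^] (- height a) \<otimes> a \<in> N"
  using cyclic_quotient[OF assms] height_eqI[OF assms] by metis

lemma height_mult:
  assumes "a \<in> A" "b \<in> A"
  shows "height (a \<otimes> b) = height a + height b"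
proof (rule height_eqI)
  show "a \<otimes> b \<in> A" using assms subgroup.m_closed[OF subgroup_A] by blast
  \<comment> \<open>The parts of \<open>a\<close> and \<open>b\<close> in \<open>N\<close> multiply
    to the part of \<open>a \<otimes> b\<close> once the first is conjugated past the power of
    \<open>t\<close> belonging to \<open>b\<close>.\<close>
  have "t [^] (- height b) \<otimes> (t [^] (- height a) \<otimes> a) \<otimes> t [^] (- (- height b)) \<otimes>
      (t [^] (- height b) \<otimes> b) \<in> N"
    using subgroup.m_closed[OF subgroup_N] conj_t_pow height_in_N assms by meson
  moreover have "t [^] (- height b) \<otimes> (t [^] (- height a) \<otimes> a) \<otimes> t [^] (- (- height b)) \<otimes>
      (t [^] (- height b) \<otimes> b) = t [^] (- (height a + height b)) \<otimes> (a \<otimes> b)"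
    using assms by (simp add: m_assoc int_pow_add_mult add.commute)
  ultimately show "t [^] (- (height a + height b)) \<otimes> (a \<otimes> b) \<in> N" by simp
qed

lemma height_pow: "height (t [^] (k::int)) = k"
  by (rule height_eqI[OF t_pow_in_A])
     (use subgroup.one_closed[OF subgroup_N] in \<open>simp flip: int_pow_mult\<close>)

lemma height_N: "v \<in> N \<Longrightarrow> height v = 0"
  by (rule height_eqI) (use N_le_A in auto)

text \<open>The cosets \<open>N t\<^sup>k\<close> are grouped into blocks of \<open>L\<close> consecutive heights, and even and odd blocks
  get disjoint palettes. Left multiplication by a power of \<open>t\<close> moves each block isometrically to
  the block of heights \<open>0..<L\<close>, which is a bounded neighbourhood of \<open>N\<close>.\<close>

lemma colorable_infinite_cyclic:
  assumes "colorable G N d" "small_index_core G N"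
  shows "colorable G A (2 * d)"
  unfolding colorable_def
proof (intro allI impI)
  fix F assume F: "finite F" "F \<subseteq> carrier G"
  \<comment> \<open>\<open>L\<close> exceeds the absolute height of every step in \<open>F\<close>,
    so no step jumps over a block. The summand 1 also keeps \<open>L\<close> positive when
    \<open>F\<close> is empty.\<close>
  define L where "L = 1 + (\<Sum>f\<in>F. \<bar>height f\<bar>)"
  have L: "L > 0" unfolding L_def by (simp add: sum_nonneg add_pos_nonneg)
  have height_F: "\<bar>height f\<bar> < L" if "f \<in> F" for f
    using member_le_sum[OF that, of "\<lambda>f. \<bar>height f\<bar>"] F(1) unfolding L_def by simp
  define T where "T = (\<lambda>i. t [^] i) ` {0..<L}"
  have T: "finite T" "T \<subseteq> carrier G" unfolding T_def by auto
  let ?F = "(\<lambda>(s, f, s'). s \<otimes> f \<otimes> inv s') ` (T \<times> F \<times> T)"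
  have "finite ?F" "?F \<subseteq> carrier G" using T F by (auto simp: subset_iff)
  then obtain x where x: "\<forall>a\<in>N. x a < d" "finitely_covers G (left_periods G N x) N"
      "uniformly_bounded G N x ?F"
    using assms(1) unfolding colorable_def by metis
  define blk where "blk a = height a div L" for a
  \<comment> \<open>The left factor moves the block of \<open>a\<close> to heights
    \<open>0..<L\<close> without changing displacements inside the block. The right factor then
    lowers the height to 0 and costs only an element of \<open>T\<close>.\<close>
  define p where "p a = t [^] (- (blk a * L)) \<otimes> a \<otimes> t [^] (- (height a mod L))" for a
  \<comment> \<open>The last binary digit of the new color holds the parity of the block, the
    remaining digits the old color; this is the doubling of the palette.\<close>
  define y where "y a = 2 * x (p a) + nat (blk a mod 2)" for a
  have pN: "p a \<in> N" if a: "a \<in> A" for a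
  proof -
    have pA: "p a \<in> A"
      unfolding p_def using a t_pow_in_A subgroup.m_closed[OF subgroup_A] by meson
    have "height (p a) = - (blk a * L) + height a + - (height a mod L)"
      unfolding p_def using a t_pow_in_A subgroup.m_closed[OF subgroup_A]
      by (simp only: height_mult height_pow)
    then have "height (p a) = 0" unfolding blk_def by (simp add: minus_mod_eq_div_mult[symmetric])
    then show ?thesis using height_in_N[OF pA] pA by simp
  qed
  have x_eq: "x (p a) = y a div 2" "nat (blk a mod 2) = y a mod 2" for a
  proof -
    have "nat (blk a mod 2) < 2" by simp
    then show "x (p a) = y a div 2" "nat (blk a mod 2) = y a mod 2" unfolding y_def by simp_all
  qed
  have bounded: "uniformly_bounded G A y F"
  proof (rule uniformly_bounded_pullback[where A = N and T = T and p = p and x = x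
        and q = "\<lambda>a. t [^] (height a mod L)" and \<beta> = "\<lambda>a. t [^] (blk a * L)"])
    fix a assume a: "a \<in> A"
    have "t [^] (blk a * L) \<otimes> p a \<otimes> t [^] (height a mod L) = a"
      unfolding p_def using a by (simp add: m_assoc int_pow_add_mult flip: int_pow_mult)
    then show "p a \<in> N \<and> t [^] (height a mod L) \<in> T \<and> t [^] (blk a * L) \<in> carrier G \<and>
        t [^] (blk a * L) \<otimes> p a \<otimes> t [^] (height a mod L) = a"
      using pN[OF a] L unfolding T_def by simp
  next
    fix a b assume ab: "a \<in> A" "b \<in> A" "y a = y b" "inv a \<otimes> b \<in> F"
    have "inv a \<otimes> b \<in> A"
      using ab subgroup.m_closed[OF subgroup_A] subgroup.m_inv_closed[OF subgroup_A] by blast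
    from height_mult[OF ab(1) this] have "height b = height a + height (inv a \<otimes> b)"
      using ab by simp
    then have "\<bar>height b - height a\<bar> < L" using height_F[OF ab(4)] by simp
    moreover have "blk a mod 2 = blk b mod 2"
      using x_eq(2)[of a] x_eq(2)[of b] ab(3) by (simp add: nat_eq_iff)
    ultimately have "blk a = blk b" unfolding blk_def by (rule div_eq_if_near_and_same_parity)
    then show "t [^] (blk a * L) = t [^] (blk b * L) \<and> x (p a) = x (p b)"
      using x_eq(1) ab(3) by simp
  qed (use F T x(3) subgroup.subset[OF subgroup_A] subgroup.subset[OF subgroup_N] in auto)
  have LN: "subgroup (left_periods G N x) G" by (rule subgroup_left_periods[OF subgroup_N])
  have LA: "subgroup (left_periods G A y) G" by (rule subgroup_left_periods[OF subgroup_A])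
  have LN_N: "left_periods G N x \<subseteq> N" unfolding left_periods_def by blast
  \<comment> \<open>Different blocks carry differently translated copies of \<open>x\<close>, so a
    common period must be a period of \<open>x\<close> after conjugation by every block translation.
    Invariance of \<open>K\<close> under \<open>A\<close> ensures this.\<close>
  obtain K where K: "K \<subseteq> left_periods G N x" "finitely_covers G K N"
    and K_conj: "\<And>a u. \<lbrakk>a \<in> A; u \<in> K\<rbrakk> \<Longrightarrow> a \<otimes> u \<otimes> inv a \<in> K"
    using invariant_subgroup_of_finite_index[OF assms(2) subgroup_N LN LN_N x(2)]
      conj_closed conj_closed' A_carrier by metis
  \<comment> \<open>A shift by a multiple of \<open>2 * L\<close> moves blocks by an even number of
    places and so respects the two palettes.\<close>
  have pow_period: "t [^] (2 * L * j) \<in> left_periods G A y" for j :: int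
  proof -
    have "y (t [^] (2 * L * j) \<otimes> a) = y a" if a: "a \<in> A" for a
    proof -
      have h: "height (t [^] (2 * L * j) \<otimes> a) = height a + (2 * j) * L"
        using height_mult[OF t_pow_in_A a] by (simp add: height_pow)
      have b: "blk (t [^] (2 * L * j) \<otimes> a) = blk a + 2 * j"
        unfolding blk_def h using L by simp
      have "p (t [^] (2 * L * j) \<otimes> a) = p a"
        unfolding p_def b unfolding h using a
        by (simp add: m_assoc int_pow_add_mult algebra_simps)
      then show ?thesis unfolding y_def b by simp
    qed
    then show ?thesis unfolding left_periods_def using t_pow_in_A by simp
  qed
  have K_period: "u \<in> left_periods G A y" if u: "u \<in> K" for u
  proof -
    have uN: "u \<in> N" using u K(1) LN_N by blast
    then have uA: "u \<in> A" using N_le_A by blast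
    have "y (u \<otimes> a) = y a" if a: "a \<in> A" for a
    proof -
      have h: "height (u \<otimes> a) = height a" using height_mult[OF uA a] height_N[OF uN] by simp
      have b: "blk (u \<otimes> a) = blk a" unfolding blk_def h ..
      \<comment> \<open>This conjugate appears when \<open>u\<close> is moved past the block
        translation in \<open>p\<close>.\<close>
      let ?u = "t [^] (- (blk a * L)) \<otimes> u \<otimes> inv (t [^] (- (blk a * L)))"
      have "p (u \<otimes> a) = ?u \<otimes> p a"
        unfolding p_def b h using a uN by (simp add: m_assoc)
      moreover have "?u \<in> left_periods G N x" using K_conj[OF t_pow_in_A u] K(1) by blast
      ultimately have "x (p (u \<otimes> a)) = x (p a)" using pN[OF a] unfolding left_periods_def by simp
      then show ?thesis unfolding y_def b by simp
    qed
    then show ?thesis unfolding left_periods_def using uA by simp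
  qed
  have "finitely_covers G (left_periods G A y) A"
  proof -
    have KN: "K \<subseteq> N" using K(1) LN_N by blast
    obtain U where U: "finite U" "U \<subseteq> carrier G"
      "\<And>a. a \<in> A \<Longrightarrow> \<exists>(j::int) u s. u \<in> K \<and> s \<in> U \<and> a = t [^] (2 * L * j) \<otimes> u \<otimes> s"
      using covering_by_powers[OF K(2) KN, of "2 * L"] L by (metis mult_pos_pos zero_less_numeral)
    have "t [^] (2 * L * j) \<otimes> u \<in> left_periods G A y" if "u \<in> K" for j :: int and u
      using subgroup.m_closed[OF LA pow_period K_period[OF that]] .
    then show ?thesis unfolding finitely_covers_def using U by metis
  qed
  moreover have "y a < 2 * d" if a: "a \<in> A" for a
  proof -
    have "x (p a) < d" using x(1) pN[OF a] by blast
    moreover have "nat (blk a mod 2) < 2" by simp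
    ultimately show ?thesis unfolding y_def by linarith
  qed
  ultimately show "\<exists>x. (\<forall>a\<in>A. x a < 2 * d) \<and> finitely_covers G (left_periods G A x) A \<and>
      uniformly_bounded G A x F"
    using bounded by blast
qed

end

text \<open>A finite quotient keeps the number of colors and an infinite one doubles it; the cases
  are told apart by whether a nonzero power of \<open>t\<close> lies in \<open>N\<close>.\<close>

lemma colorable_extension:
  assumes "colorable G N d" "small_index_core G N"
  shows "\<exists>d'. colorable G A d'"
proof (cases "\<exists>k::int. t [^] k \<in> N \<and> k \<noteq> 0")
  case True
  then have "finitely_covers G N A" using finitely_covers_torsion by blast
  then show ?thesis
    using colorable_finite_overgroup[OF subgroup_N subgroup_A _ N_le_A assms(1)] by blast
next
  case False
  then have "colorable G A (2 * d)" using colorable_infinite_cyclic assms by blast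
  then show ?thesis by blast
qed

end

section \<open>Induction along a polycyclic series\<close>

context group
begin

text \<open>A lift \<open>t\<close> of a generator of the quotient translates normality and
  cyclicity into statements about elements, so that the quotient group does not appear
  elsewhere.\<close>

lemma cyclic_extension_of_normal:
  assumes N: "subgroup N G" and A: "subgroup A G"
    and normal: "N \<lhd> G\<lparr>carrier := A\<rparr>" and cyc: "cyclic_group (G\<lparr>carrier := A\<rparr> Mod N)"
  shows "\<exists>t. cyclic_extension G N A t"
proof -
  let ?A = "G\<lparr>carrier := A\<rparr>"
  interpret n: normal N ?A by fact
  interpret q: group "?A Mod N" by (rule n.factorgroup_is_group)
  have NA: "N \<subseteq> A" using n.subset by simp
  have AG: "a \<in> carrier G" if "a \<in> A" for a using subgroup.mem_carrier[OF A that] .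
  obtain Y where Y: "Y \<in> carrier (?A Mod N)"
    "carrier (?A Mod N) = range (\<lambda>k::int. Y [^]\<^bsub>?A Mod N\<^esub> k)"
    using cyc q.cyclic_group by blast
  obtain t where t: "t \<in> A" "Y = N #>\<^bsub>?A\<^esub> t" using Y(1) unfolding carrier_FactGroup by auto
  have conj: "a \<otimes> v \<otimes> inv a \<in> N" if "a \<in> A" "v \<in> N" for a v
    using n.inv_op_closed2[of a v] that m_inv_consistent[OF A] by simp
  have quot: "\<exists>k::int. t [^] (- k) \<otimes> a \<in> N" if a: "a \<in> A" for a
  proof -
    have "N #>\<^bsub>?A\<^esub> a \<in> carrier (?A Mod N)" using a by (auto simp: carrier_FactGroup)
    then obtain k :: int where "N #>\<^bsub>?A\<^esub> a = Y [^]\<^bsub>?A Mod N\<^esub> k" using Y(2) by blast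
    also have "\<dots> = N #>\<^bsub>?A\<^esub> (t [^] k)"
      using n.FactGroup_int_pow[of t k] t int_pow_consistent[OF A t(1)] by simp
    finally have eq: "N #>\<^bsub>?A\<^esub> a = N #>\<^bsub>?A\<^esub> (t [^] k)" .
    have "a \<in> N #>\<^bsub>?A\<^esub> a"
      using a AG[OF a] subgroup.one_closed[OF N] unfolding r_coset_def by force
    then obtain v where v: "v \<in> N" "a = v \<otimes> t [^] k" unfolding eq unfolding r_coset_def by auto
    \<comment> \<open>The coset description has the power of \<open>t\<close> on the right of
      \<open>v\<close>, the locale wants it on the left; the two differ by a conjugation that
      preserves \<open>N\<close>.\<close>
    have "t [^] (- k) \<otimes> a = t [^] (- k) \<otimes> v \<otimes> inv (t [^] (- k))"
      unfolding v(2) using v(1) NA AG t(1) by (simp add: m_assoc int_pow_neg subset_iff)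
    moreover have "t [^] (- k) \<in> A" using subgroup_int_pow_closed[OF A t(1)] .
    ultimately have "t [^] (- k) \<otimes> a \<in> N" using conj v(1) by metis
    then show ?thesis by blast
  qed
  have "cyclic_extension G N A t"
    by (intro cyclic_extension.intro cyclic_extension_axioms.intro group_axioms)
       (fact N A NA t(1) conj quot)+
  then show ?thesis by blast
qed

text \<open>\<open>small_index_core\<close> is carried through the induction because the next cyclic
  extension uses it to find invariant periods. Finite generation is carried along to produce a
  generating set of the whole group.\<close>

lemma polycyclic_subgroup_colorable:
  assumes H: "subgroup H G" and pc: "polycyclic (G\<lparr>carrier := H\<rparr>)"
  shows "(\<exists>d. colorable G H d) \<and> finitely_generated_subgroup G H"
proof -
  obtain n and Gs :: "nat \<Rightarrow> 'a set" where Gs: "Gs 0 = {\<one>}" "Gs n = H"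
      "\<And>i. i \<le> n \<Longrightarrow> subgroup (Gs i) (G\<lparr>carrier := H\<rparr>)"
      "\<And>i. i < n \<Longrightarrow> Gs i \<lhd> G\<lparr>carrier := Gs (Suc i)\<rparr>"
      "\<And>i. i < n \<Longrightarrow> cyclic_group (G\<lparr>carrier := Gs (Suc i)\<rparr> Mod Gs i)"
    using pc unfolding polycyclic_def by auto
  have sub: "subgroup (Gs i) G" if "i \<le> n" for i
    using incl_subgroup[OF H Gs(3)[OF that]] .
  have "(\<exists>d. colorable G (Gs i) d) \<and> small_index_core G (Gs i) \<and>
      finitely_generated_subgroup G (Gs i)" if "i \<le> n" for i
    using that
  proof (induction i)
    case 0
    have cover: "finitely_covers G {\<one>} {\<one>}"
      unfolding finitely_covers_def by (rule exI[of _ "{\<one>}"]) simp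
    have triv: "subgroup {\<one>} G" using sub[of 0] Gs(1) by simp
    have "colorable G {\<one>} 1"
      unfolding colorable_def
    proof (intro allI impI)
      fix F
      have "left_periods G {\<one>} (\<lambda>_. 0) = {\<one>}" unfolding left_periods_def by auto
      moreover have "uniformly_bounded G {\<one>} (\<lambda>_. 0) F"
      proof -
        have "b = \<one>" if "(\<one>, b) \<in> (monochromatic_edges G {\<one>} (\<lambda>_. 0) F)\<^sup>*" for b
          using that by (induction rule: rtrancl_induct) (auto simp: monochromatic_edges_def)
        then have "\<forall>a\<in>{\<one>}. \<forall>b. (a, b) \<in> (monochromatic_edges G {\<one>} (\<lambda>_. 0) F)\<^sup>* \<longrightarrow>
            inv a \<otimes> b \<in> {\<one>}"
          by fastforce
        then show ?thesis unfolding uniformly_bounded_def by (intro exI[of _ "{\<one>}"]) simp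
      qed
      ultimately show "\<exists>x. (\<forall>a\<in>{\<one>}. x a < (1::nat)) \<and>
          finitely_covers G (left_periods G {\<one>} x) {\<one>} \<and> uniformly_bounded G {\<one>} x F"
        using cover by (intro exI[of _ "\<lambda>_. 0"]) simp
    qed
    moreover have "small_index_core G {\<one>}"
      unfolding small_index_core_def index_le_def
      using triv cover subgroup.one_closed by blast
    moreover have "finitely_generated_subgroup G {\<one>}"
      unfolding finitely_generated_subgroup_def using generate_empty by blast
    ultimately show ?case unfolding Gs(1) by blast
  next
    case (Suc i)
    then have i: "i \<le> n" "i < n" by simp_all
    obtain t where t: "cyclic_extension G (Gs i) (Gs (Suc i)) t"
      using cyclic_extension_of_normal[OF sub[OF i(1)] sub[OF Suc.prems] Gs(4)[OF i(2)] Gs(5)[OF i(2)]]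
      by blast
    show ?case
      using Suc.IH[OF i(1)] cyclic_extension.colorable_extension[OF t]
        cyclic_extension.small_index_core_extension[OF t]
        cyclic_extension.finitely_generated_extension[OF t] by blast
  qed
  then show ?thesis using Gs(2) by blast
qed

section \<open>From colorability to periodic asymptotic dimension\<close>

lemma finite_index_finitely_covers:
  assumes "finite_index G H"
  shows "finitely_covers G H (carrier G)"
proof -
  have H: "subgroup H G" and fin: "finite (rcosets H)" using assms unfolding finite_index_def by auto
  have "\<forall>C\<in>rcosets H. \<exists>a\<in>carrier G. C = H #> a" unfolding RCOSETS_def by auto
  then obtain f where f: "\<And>C. C \<in> rcosets H \<Longrightarrow> f C \<in> carrier G \<and> C = H #> f C" by metis
  have "\<exists>h\<in>H. \<exists>s\<in>f ` (rcosets H). a = h \<otimes> s" if a: "a \<in> carrier G" for a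
  proof -
    have C: "H #> a \<in> rcosets H" using a by (rule rcosetsI[OF subgroup.subset[OF H]])
    have "a \<in> H #> f (H #> a)" using rcos_self[OF a H] f[OF C] by simp
    then show ?thesis using C unfolding r_coset_def by blast
  qed
  moreover have "f ` (rcosets H) \<subseteq> carrier G" using f by blast
  ultimately show ?thesis unfolding finitely_covers_def using fin by blast
qed

lemma finitely_covers_finite_index:
  assumes "subgroup H G" "finitely_covers G H (carrier G)"
  shows "finite_index G H"
proof -
  obtain T where T: "finite T" "T \<subseteq> carrier G" "\<forall>a\<in>carrier G. \<exists>h\<in>H. \<exists>s\<in>T. a = h \<otimes> s"
    using assms(2) unfolding finitely_covers_def by blast
  have "H #> a \<in> (\<lambda>s. H #> s) ` T" if a: "a \<in> carrier G" for a
  proof -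
    obtain h s where hs: "h \<in> H" "s \<in> T" "a = h \<otimes> s" using T(3) a by blast
    then have "a \<in> H #> s" unfolding r_coset_def by blast
    then have "H #> s = H #> a" using repr_independence[OF _ _ assms(1)] hs(2) T(2) by blast
    then show ?thesis using hs(2) by blast
  qed
  then have "rcosets H \<subseteq> (\<lambda>s. H #> s) ` T" unfolding RCOSETS_def by blast
  then show ?thesis unfolding finite_index_def using assms(1) T(1) finite_surj by blast
qed

lemma finitely_generated_finite_overgroup:
  assumes "finitely_generated_subgroup G H" "finitely_covers G H (carrier G)"
  shows "\<exists>S. finite_symmetric_generating_set G S"
proof -
  obtain S where S: "finite S" "S \<subseteq> carrier G" "generate G S = H"
    using assms(1) unfolding finitely_generated_subgroup_def by blast
  obtain T where T: "finite T" "T \<subseteq> carrier G" "\<forall>a\<in>carrier G. \<exists>h\<in>H. \<exists>s\<in>T. a = h \<otimes> s"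
    using assms(2) unfolding finitely_covers_def by blast
  let ?S = "(S \<union> T) \<union> (\<lambda>s. inv s) ` (S \<union> T)"
  have S': "?S \<subseteq> carrier G" using S(2) T(2) by auto
  have sub: "subgroup (generate G ?S) G" by (rule generate_is_subgroup[OF S'])
  have "a \<in> generate G ?S" if a: "a \<in> carrier G" for a
  proof -
    obtain h s where hs: "h \<in> H" "s \<in> T" "a = h \<otimes> s" using T(3) a by blast
    have "h \<in> generate G ?S" using hs(1) S(3) mono_generate[of S ?S] by blast
    moreover have "s \<in> generate G ?S" using hs(2) by (intro generate.incl) blast
    ultimately show ?thesis using subgroup.m_closed[OF sub] hs(3) by blast
  qed
  then have "generate G ?S = carrier G" using subgroup.subset[OF sub] by blast
  moreover have "\<forall>s\<in>?S. inv s \<in> ?S" using S(2) T(2) by (auto simp: subset_iff)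
  ultimately show ?thesis
    unfolding finite_symmetric_generating_set_def using S(1) T(1) S' by (intro exI[of _ ?S]) simp
qed

text \<open>The \<open>LEAST\<close> in \<open>word_norm\<close> is meaningful only if some word
  represents \<open>g\<close>. Symmetry of \<open>S\<close> supplies a letter for each inverse
  produced by \<open>generate\<close>.\<close>

lemma word_exists:
  assumes "finite_symmetric_generating_set G S" "g \<in> carrier G"
  shows "\<exists>ws. length ws = word_norm G S g \<and> set ws \<subseteq> S \<and> foldr (\<otimes>) ws \<one> = g"
proof -
  have S: "S \<subseteq> carrier G" "\<And>s. s \<in> S \<Longrightarrow> inv s \<in> S" "generate G S = carrier G"
    using assms(1) unfolding finite_symmetric_generating_set_def by auto
  have word: "foldr (\<otimes>) ws \<one> \<in> carrier G" if "set ws \<subseteq> S" for ws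
    using that S(1) by (induction ws) auto
  have append: "foldr (\<otimes>) (us @ vs) \<one> = foldr (\<otimes>) us \<one> \<otimes> foldr (\<otimes>) vs \<one>"
    if "set us \<subseteq> S" "set vs \<subseteq> S" for us vs
    using that(1)
  proof (induction us)
    case Nil
    then show ?case using word[OF that(2)] by simp
  next
    case (Cons u us)
    then show ?case using word[of us] word[OF that(2)] S(1) by (simp add: m_assoc subset_iff)
  qed
  have "g \<in> generate G S" using assms(2) S(3) by simp
  then have "\<exists>ws. set ws \<subseteq> S \<and> foldr (\<otimes>) ws \<one> = g"
  proof (induction rule: generate.induct)
    case one
    show ?case by (intro exI[of _ "[]"]) simp
  next
    case (incl h)
    then show ?case using S(1) by (intro exI[of _ "[h]"]) auto
  next
    case (inv h)
    then show ?case using S(1,2) by (intro exI[of _ "[inv h]"]) auto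
  next
    case (eng h1 h2)
    then obtain us vs where "set us \<subseteq> S" "foldr (\<otimes>) us \<one> = h1" "set vs \<subseteq> S" "foldr (\<otimes>) vs \<one> = h2"
      by blast
    then show ?case using append[of us vs] by (intro exI[of _ "us @ vs"]) (simp del: foldr_append)
  qed
  then have "\<exists>k ws. length ws = k \<and> set ws \<subseteq> S \<and> foldr (\<otimes>) ws \<one> = g" by blast
  then show ?thesis unfolding word_norm_def by (rule LeastI_ex)
qed

text \<open>There are finitely many words of length at most \<open>r\<close> over \<open>S\<close>.
  This allows a ball to be used as the step set \<open>F\<close>.\<close>

lemma finite_word_norm_ball:
  assumes "finite_symmetric_generating_set G S"
  shows "finite {g \<in> carrier G. word_norm G S g \<le> r}"
proof -
  have "{g \<in> carrier G. word_norm G S g \<le> r} \<subseteq>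
      (\<lambda>ws. foldr (\<otimes>) ws \<one>) ` {ws. set ws \<subseteq> S \<and> length ws \<le> r}"
  proof
    fix g assume g: "g \<in> {g \<in> carrier G. word_norm G S g \<le> r}"
    then obtain ws where "length ws = word_norm G S g" "set ws \<subseteq> S" "foldr (\<otimes>) ws \<one> = g"
      using word_exists[OF assms] by blast
    then show "g \<in> (\<lambda>ws. foldr (\<otimes>) ws \<one>) ` {ws. set ws \<subseteq> S \<and> length ws \<le> r}"
      using g by (intro image_eqI[of _ _ ws]) auto
  qed
  moreover have "finite {ws. set ws \<subseteq> S \<and> length ws \<le> r}"
    using assms unfolding finite_symmetric_generating_set_def by (intro finite_lists_length_le) simp
  ultimately show ?thesis by (rule finite_surj[rotated])
qed

text \<open>The shift by \<open>g\<close> multiplies arguments by \<open>inv g\<close>, which makes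
  no difference because the periods form a group. Adding one moves the colors from
  \<open>{0..<d}\<close> to \<open>{1..d}\<close>.\<close>

lemma stabilizer_shift_eq_left_periods:
  "stabilizer G (shift G) (\<lambda>g\<in>carrier G. x g + 1) = left_periods G (carrier G) x"
proof -
  have sub: "subgroup (left_periods G (carrier G) x) G"
    by (rule subgroup_left_periods[OF subgroup_self])
  have "shift G g (\<lambda>g\<in>carrier G. x g + 1) = (\<lambda>g\<in>carrier G. x g + 1) \<longleftrightarrow>
      inv g \<in> left_periods G (carrier G) x" if "g \<in> carrier G" for g
    using that unfolding shift_def left_periods_def by (auto simp: fun_eq_iff restrict_def)
  moreover have "inv g \<in> left_periods G (carrier G) x \<longleftrightarrow> g \<in> left_periods G (carrier G) x"
    if "g \<in> carrier G" for g
    using that subgroup.m_inv_closed[OF sub] inv_inv by metis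
  moreover have "left_periods G (carrier G) x \<subseteq> carrier G" by (rule subgroup.subset[OF sub])
  ultimately show ?thesis unfolding stabilizer_def by blast
qed

lemma pdim_finite_of_colorable:
  assumes "finite_symmetric_generating_set G S" "colorable G (carrier G) d"
  shows "pdim G S < \<infinity>"
proof -
  have main: "\<exists>m. \<exists>z\<in>bounded_colorings G S d r m. periodic G z" for r
  proof -
    define F where "F = {g \<in> carrier G. word_norm G S g \<le> r}"
    have "finite F" "F \<subseteq> carrier G" unfolding F_def using finite_word_norm_ball[OF assms(1)] by auto
    then obtain x where x: "\<forall>a\<in>carrier G. x a < d"
        "finitely_covers G (left_periods G (carrier G) x) (carrier G)"
        "uniformly_bounded G (carrier G) x F"
      using assms(2) unfolding colorable_def by metis
    obtain B where B: "finite B" "B \<subseteq> carrier G" "\<And>a b. \<lbrakk>a \<in> carrier G;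
        (a, b) \<in> (monochromatic_edges G (carrier G) x F)\<^sup>*\<rbrakk> \<Longrightarrow> inv a \<otimes> b \<in> B"
      using x(3) unfolding uniformly_bounded_def by metis
    define z where "z = (\<lambda>g\<in>carrier G. x g + 1)"
    have "z \<in> configurations G d"
      unfolding configurations_def z_def using x(1) by (auto simp: Suc_le_eq)
    moreover have "finite C \<and> card C \<le> card B" if C: "C \<in> color_components G S r z c" for c C
    proof -
      obtain a where a: "a \<in> carrier G" "C = (color_edges G S r z c)\<^sup>* `` {a}"
        using C unfolding color_components_def color_vertices_def by auto
      have sub: "color_edges G S r z c \<subseteq> monochromatic_edges G (carrier G) x F"
        unfolding color_edges_def color_vertices_def monochromatic_edges_def z_def F_def by auto
      have "C \<subseteq> (\<lambda>b. a \<otimes> b) ` B"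
      proof
        fix b assume "b \<in> C"
        then have ab: "(a, b) \<in> (color_edges G S r z c)\<^sup>*" using a(2) by simp
        then have "b \<in> carrier G"
          by (cases rule: rtranclE) (use a(1) in \<open>auto simp: color_edges_def color_vertices_def\<close>)
        moreover have "inv a \<otimes> b \<in> B" using B(3)[OF a(1)] rtrancl_mono[OF sub] ab by blast
        ultimately show "b \<in> (\<lambda>b. a \<otimes> b) ` B"
          using a(1) by (intro image_eqI[of _ _ "inv a \<otimes> b"]) simp_all
      qed
      then have "finite C" "card C \<le> card ((\<lambda>b. a \<otimes> b) ` B)"
        using B(1) by (auto intro: finite_subset card_mono)
      then show ?thesis using card_image_le[OF B(1), of "\<lambda>b. a \<otimes> b"] by simp
    qed
    ultimately have "z \<in> bounded_colorings G S d r (card B)"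
      unfolding bounded_colorings_def by blast
    moreover have "periodic G z"
      unfolding periodic_def z_def stabilizer_shift_eq_left_periods
      by (rule finitely_covers_finite_index[OF subgroup_left_periods[OF subgroup_self] x(2)])
    ultimately show ?thesis by blast
  qed
  \<comment> \<open>\<open>d\<close> colors give the bound \<open>d - 1\<close>, so truncated
    subtraction must be excluded. The coloring for empty \<open>F\<close> assigns
    \<open>\<one>\<close> a color below \<open>d\<close>, hence \<open>d\<close> is
    positive.\<close>
  have "\<exists>x :: 'a \<Rightarrow> nat. \<forall>a\<in>carrier G. x a < d"
    using assms(2) unfolding colorable_def by (meson empty_subsetI finite.emptyI)
  then have "d > 0" using one_closed by fastforce
  then have "pdim G S \<le> enat (d - 1)"
    unfolding pdim_def using main by (intro Inf_lower) auto
  then show ?thesis using le_less_trans enat_ord_code(4) by blast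
qed

end

theorem corollary9p7:
  fixes G :: "('a, 'b) monoid_scheme"
  assumes "group G" and "virtually_polycyclic G"
  shows "(\<exists>S. finite_symmetric_generating_set G S) \<and>
         (\<forall>S. finite_symmetric_generating_set G S \<longrightarrow> pdim G S < \<infinity>)"
proof -
  interpret group G by fact
  obtain H where H: "finite_index G H" "polycyclic (G\<lparr>carrier := H\<rparr>)"
    using assms(2) unfolding virtually_polycyclic_def by blast
  have sub: "subgroup H G" using H(1) unfolding finite_index_def by blast
  have cov: "finitely_covers G H (carrier G)" by (rule finite_index_finitely_covers[OF H(1)])
  obtain d where d: "colorable G H d" and fg: "finitely_generated_subgroup G H"
    using polycyclic_subgroup_colorable[OF sub H(2)] by blast
  have "colorable G (carrier G) d"
    by (rule colorable_finite_overgroup[OF sub subgroup_self cov subgroup.subset[OF sub] d])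
  then show ?thesis
    using finitely_generated_finite_overgroup[OF fg cov] pdim_finite_of_colorable by blast
qed

end
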